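(* Let $L$ be a finite semidistrim lattice and $x\in L$. Then $\mathsf{Row}_L(x)$ is a maximal element of the set $\{z\in L:\mathsf{Pop}^\downarrow_L(x)=x\wedge z\}$, and $\mathsf{Row}_L^{-1}(x)$ is a minimal element of the set $\{z\in L:\mathsf{Pop}^\uparrow_L(x)=x\vee z\}$.
   Context: All lattices are finite. For a lattice $L$, $\mathcal{J}_L$ (resp. $\mathcal{M}_L$) is the set of join-irreducible (resp. meet-irreducible) elements; for $j\in\mathcal{J}_L$, $j_*$ is the unique element covered by $j$, and for $m\in\mathcal{M}_L$, $m^*$ is the unique element covering $m$. Let $\mathcal{M}_L(j)=\max\{z\in L: j_*=j\wedge z\}$ and $\mathcal{J}_L(m)=\min\{z\in L: m^*=m\vee z\}$. A pairing on $L$ is a bijection $\kappa:\mathcal{J}_L\to\mathcal{M}_L$ with $\kappa(j)\in\mathcal{M}_L(j)$ for all $j$ and $\kappa^{-1}(m)\in\mathcal{J}_L(m)$ for all $m$; $L$ is uniquely paired if it has exactly one pairing, denoted $\kappa_L$. A prime pair is a pair $(j_0,m_0)$ with $L=[\hat0,m_0]\sqcup[j_0,\hat1]$. A uniquely paired lattice $L$ is compatibly dismantlable if $|L|=1$ or there is a prime pair $(j_0,m_0)$ such that: (i) $[j_0,\hat1]$ is compatibly dismantlable and $\alpha(j)=j_0\vee j$ defines a bijection $\{j\in\mathcal{J}_L: j_0\le\kappa_L(j)\}\to\mathcal{J}_{[j_0,\hat1]}$ with $\kappa_{[j_0,\hat1]}(\alpha(j))=\kappa_L(j)$; (ii) $[\hat0,m_0]$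 is compatibly dismantlable and $\beta(m)=m_0\wedge m$ defines a bijection $\{m\in\mathcal{M}_L:\kappa_L^{-1}(m)\le m_0\}\to\mathcal{M}_{[\hat0,m_0]}$ with $\kappa_{[\hat0,m_0]}^{-1}(\beta(m))=\kappa_L^{-1}(m)$. The Galois graph $G_L$ is the directed graph on $\mathcal{J}_L$ with an edge $j\to j'$ iff $j\ne j'$ and $j\not\le\kappa_L(j')$. For $x\in L$ let $J_L(x)=\{j\in\mathcal{J}_L:j\le x\}$ and $M_L(x)=\{j\in\mathcal{J}_L:\kappa_L(j)\ge x\}$. For a compatibly dismantlable $L$, for every cover $x\lessdot y$ the set $M_L(x)\cap J_L(y)$ has exactly one element $j_{xy}$; set $\mathcal{D}_L(x)=\{j_{yx}:y\lessdot x\}$ and $\mathcal{U}_L(x)=\{j_{xy}:x\lessdot y\}$. $L$ is semidistrim if it is compatibly dismantlable and $\mathcal{D}_L(x)$, $\mathcal{U}_L(x)$ are independent sets (no two elements adjacent) of $G_L$ for all $x\in L$. For semidistrim $L$, the maps $\mathcal{D}_L$ and $\mathcal{U}_L$ are bijections from $L$ to the set of independent sets of $G_L$, and rowmotion $\mathsf{Row}_L:L\to L$ is the bijection defined by $\mathcal{U}_L(\mathsf{Row}_L(x))=\mathcal{D}_L(x)$. For any lattice, $\mathsf{Pop}^\downarrow_L(x)=x\wedge\bigwedge\{y:y\lessdot x\}$ and $\mathsf{Pop}^\uparrow_L(x)=x\vee\bigvee\{y:x\lessdot y\}$. *)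

theory Defs
  imports Main "HOL-Library.FuncSet"
begin

text \<open>
  A finite lattice is represented by its carrier: a finite nonempty set \<open>L\<close> closed under
  \<^const>\<open>inf\<close> and \<^const>\<open>sup\<close> in some type of class \<^class>\<open>lattice\<close>
  (take \<open>L = UNIV\<close> for a finite lattice type). The intervals from the least
  element up to \<open>m\<close> and from \<open>j\<close> up to the greatest element are then
  \<open>L \<inter> {..m}\<close> and \<open>L \<inter> {j..}\<close>; they are again finite lattices with the same operations.
\<close>

definition finite_lattice_on :: "'a::lattice set \<Rightarrow> bool" where
  "finite_lattice_on L \<longleftrightarrow>
     finite L \<and> L \<noteq> {} \<and> (\<forall>x\<in>L. \<forall>y\<in>L. inf x y \<in> L \<and> sup x y \<in> L)"

definition maximal_elements :: "'a::order set \<Rightarrow> 'a set" where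
  "maximal_elements S = {x \<in> S. \<not> (\<exists>y\<in>S. x < y)}"

definition minimal_elements :: "'a::order set \<Rightarrow> 'a set" where
  "minimal_elements S = {x \<in> S. \<not> (\<exists>y\<in>S. y < x)}"

definition cover :: "'a::order set \<Rightarrow> 'a \<Rightarrow> 'a \<Rightarrow> bool" where
  "cover L x y \<longleftrightarrow> x \<in> L \<and> y \<in> L \<and> x < y \<and> \<not> (\<exists>z\<in>L. x < z \<and> z < y)"

definition join_irreducibles :: "'a::lattice set \<Rightarrow> 'a set" where
  "join_irreducibles L = {j \<in> L. \<exists>!x. cover L x j}"

definition meet_irreducibles :: "'a::lattice set \<Rightarrow> 'a set" where
  "meet_irreducibles L = {m \<in> L. \<exists>!y. cover L m y}"

text \<open>\<open>lower_cover L j\<close> is $j_*$ and \<open>upper_cover L m\<close> is $m^*$.\<close>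

definition lower_cover :: "'a::lattice set \<Rightarrow> 'a \<Rightarrow> 'a" where
  "lower_cover L j = (THE x. cover L x j)"

definition upper_cover :: "'a::lattice set \<Rightarrow> 'a \<Rightarrow> 'a" where
  "upper_cover L m = (THE y. cover L m y)"

text \<open>The sets $\mathcal{M}_L(j)$ and $\mathcal{J}_L(m)$.\<close>

definition meet_candidates :: "'a::lattice set \<Rightarrow> 'a \<Rightarrow> 'a set" where
  "meet_candidates L j = maximal_elements {z \<in> L. lower_cover L j = inf j z}"

definition join_candidates :: "'a::lattice set \<Rightarrow> 'a \<Rightarrow> 'a set" where
  "join_candidates L m = minimal_elements {z \<in> L. upper_cover L m = sup m z}"

text \<open>
  Pairings are maps defined on the join-irreducibles only; extensionality fixes their
  values elsewhere, so that \<open>\<exists>!\<close> and \<open>THE\<close> below refer to the values on the join-irreducibles.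
\<close>

definition pairing :: "'a::lattice set \<Rightarrow> ('a \<Rightarrow> 'a) \<Rightarrow> bool" where
  "pairing L k \<longleftrightarrow>
     k \<in> extensional (join_irreducibles L) \<and>
     bij_betw k (join_irreducibles L) (meet_irreducibles L) \<and>
     (\<forall>j\<in>join_irreducibles L. k j \<in> meet_candidates L j) \<and>
     (\<forall>m\<in>meet_irreducibles L. inv_into (join_irreducibles L) k m \<in> join_candidates L m)"

definition uniquely_paired :: "'a::lattice set \<Rightarrow> bool" where
  "uniquely_paired L \<longleftrightarrow> (\<exists>!k. pairing L k)"

definition kappa :: "'a::lattice set \<Rightarrow> 'a \<Rightarrow> 'a" where
  "kappa L = (THE k. pairing L k)"

definition kappa_inv :: "'a::lattice set \<Rightarrow> 'a \<Rightarrow> 'a" where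
  "kappa_inv L = inv_into (join_irreducibles L) (kappa L)"

definition prime_pair :: "'a::lattice set \<Rightarrow> 'a \<Rightarrow> 'a \<Rightarrow> bool" where
  "prime_pair L j0 m0 \<longleftrightarrow>
     j0 \<in> L \<and> m0 \<in> L \<and>
     L = (L \<inter> {..m0}) \<union> (L \<inter> {j0..}) \<and> (L \<inter> {..m0}) \<inter> (L \<inter> {j0..}) = {}"

definition compatible_above :: "'a::lattice set \<Rightarrow> 'a \<Rightarrow> bool" where
  "compatible_above L j0 \<longleftrightarrow>
     bij_betw (\<lambda>j. sup j0 j) {j \<in> join_irreducibles L. j0 \<le> kappa L j}
       (join_irreducibles (L \<inter> {j0..})) \<and>
     (\<forall>j\<in>join_irreducibles L. j0 \<le> kappa L j \<longrightarrow>
        kappa (L \<inter> {j0..}) (sup j0 j) = kappa L j)"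

definition compatible_below :: "'a::lattice set \<Rightarrow> 'a \<Rightarrow> bool" where
  "compatible_below L m0 \<longleftrightarrow>
     bij_betw (\<lambda>m. inf m0 m) {m \<in> meet_irreducibles L. kappa_inv L m \<le> m0}
       (meet_irreducibles (L \<inter> {..m0})) \<and>
     (\<forall>m\<in>meet_irreducibles L. kappa_inv L m \<le> m0 \<longrightarrow>
        kappa_inv (L \<inter> {..m0}) (inf m0 m) = kappa_inv L m)"

inductive compatibly_dismantlable :: "'a::lattice set \<Rightarrow> bool" where
  singleton:
    "uniquely_paired L \<Longrightarrow> card L = 1 \<Longrightarrow> compatibly_dismantlable L"
| dismantle:
    "uniquely_paired L \<Longrightarrow> prime_pair L j0 m0 \<Longrightarrow>
     compatibly_dismantlable (L \<inter> {j0..}) \<Longrightarrow> compatible_above L j0 \<Longrightarrow>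
     compatibly_dismantlable (L \<inter> {..m0}) \<Longrightarrow> compatible_below L m0 \<Longrightarrow>
     compatibly_dismantlable L"

definition galois_graph :: "'a::lattice set \<Rightarrow> 'a rel" where
  "galois_graph L =
     {(j, j'). j \<in> join_irreducibles L \<and> j' \<in> join_irreducibles L \<and>
               j \<noteq> j' \<and> \<not> j \<le> kappa L j'}"

definition independent_set :: "'a::lattice set \<Rightarrow> 'a set \<Rightarrow> bool" where
  "independent_set L I \<longleftrightarrow>
     I \<subseteq> join_irreducibles L \<and> (\<forall>i\<in>I. \<forall>j\<in>I. (i, j) \<notin> galois_graph L)"

definition J_set :: "'a::lattice set \<Rightarrow> 'a \<Rightarrow> 'a set" where
  "J_set L x = {j \<in> join_irreducibles L. j \<le> x}"

definition M_set :: "'a::lattice set \<Rightarrow> 'a \<Rightarrow> 'a set" where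
  "M_set L x = {j \<in> join_irreducibles L. x \<le> kappa L j}"

text \<open>
  The label $j_{xy}$ of a cover of \<open>x\<close> by \<open>y\<close>; the intersection is a singleton whenever
  \<open>L\<close> is compatibly dismantlable.
\<close>

definition cover_label :: "'a::lattice set \<Rightarrow> 'a \<Rightarrow> 'a \<Rightarrow> 'a" where
  "cover_label L x y = the_elem (M_set L x \<inter> J_set L y)"

definition downward_labels :: "'a::lattice set \<Rightarrow> 'a \<Rightarrow> 'a set" where
  "downward_labels L x = {cover_label L y x | y. cover L y x}"

definition upward_labels :: "'a::lattice set \<Rightarrow> 'a \<Rightarrow> 'a set" where
  "upward_labels L x = {cover_label L x y | y. cover L x y}"

definition semidistrim :: "'a::lattice set \<Rightarrow> bool" where
  "semidistrim L \<longleftrightarrow>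
     compatibly_dismantlable L \<and>
     (\<forall>x\<in>L. independent_set L (downward_labels L x) \<and> independent_set L (upward_labels L x))"

text \<open>
  Well defined for semidistrim \<open>L\<close>, where \<^const>\<open>downward_labels\<close> and
  \<^const>\<open>upward_labels\<close> are bijections from \<open>L\<close> onto the independent sets.
\<close>

definition rowmotion :: "'a::lattice set \<Rightarrow> 'a \<Rightarrow> 'a" where
  "rowmotion L x = (THE z. z \<in> L \<and> upward_labels L z = downward_labels L x)"

definition rowmotion_inv :: "'a::lattice set \<Rightarrow> 'a \<Rightarrow> 'a" where
  "rowmotion_inv L = inv_into L (rowmotion L)"

text \<open>
  Inserting \<open>x\<close> accounts for the outer meet (join) with \<open>x\<close>; in particular the value is \<open>x\<close>
  itself if \<open>x\<close> covers nothing (is covered by nothing).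
\<close>

definition pop_down :: "'a::lattice set \<Rightarrow> 'a \<Rightarrow> 'a" where
  "pop_down L x = Inf_fin (insert x {y. cover L y x})"

definition pop_up :: "'a::lattice set \<Rightarrow> 'a \<Rightarrow> 'a" where
  "pop_up L x = Sup_fin (insert x {y. cover L x y})"

end

theory Submission
  imports Defs
begin

text \<open>
  The label of a cover \<open>y\<close> of \<open>x\<close> lies below \<open>y\<close> but not below \<open>x\<close>, so every element is
  the join of its downward labels and the meet of the \<open>\<kappa>\<close>-images of its upward labels. Hence
  both labellings are injective. Splitting the independent sets of the Galois graph along a
  prime pair shows inductively that there are as many of them as elements of \<open>L\<close>, so both
  labellings of a semidistrim lattice are bijections onto the independent sets, and rowmotion
  is well defined. If \<open>y\<close> is covered by \<open>x\<close> with label \<open>j\<close> then $y = x \wedge \kappa(j)$;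
  intersecting over all such \<open>y\<close> gives
  $\mathsf{Pop}^\downarrow(x) = x \wedge \mathsf{Row}(x)$. Anything strictly above
  $\mathsf{Row}(x)$ lies above a downward label \<open>j\<close> of \<open>x\<close>, while
  $\mathsf{Row}(x) \le \kappa(j)$; this gives maximality. The second claim is dual.
\<close>

section \<open>Covers and pairings\<close>

lemma finite_lattice_onD:
  assumes "finite_lattice_on L"
  shows "finite L" "x \<in> L \<Longrightarrow> y \<in> L \<Longrightarrow> inf x y \<in> L" "x \<in> L \<Longrightarrow> y \<in> L \<Longrightarrow> sup x y \<in> L"
  using assms by (auto simp: finite_lattice_on_def)

lemma finite_lattice_on_atMost:
  "finite_lattice_on L \<Longrightarrow> m \<in> L \<Longrightarrow> finite_lattice_on (L \<inter> {..m})"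
  by (auto simp: finite_lattice_on_def le_infI1)

lemma finite_lattice_on_atLeast:
  "finite_lattice_on L \<Longrightarrow> j \<in> L \<Longrightarrow> finite_lattice_on (L \<inter> {j..})"
  by (auto simp: finite_lattice_on_def le_supI1)

lemma Inf_fin_in_finite_lattice:
  assumes "finite_lattice_on L" "finite S" "S \<noteq> {}" "S \<subseteq> L"
  shows "Inf_fin S \<in> L"
  using assms(2-4) by (induction rule: finite_ne_induct) (auto intro: finite_lattice_onD[OF assms(1)])

lemma Sup_fin_in_finite_lattice:
  assumes "finite_lattice_on L" "finite S" "S \<noteq> {}" "S \<subseteq> L"
  shows "Sup_fin S \<in> L"
  using assms(2-4) by (induction rule: finite_ne_induct) (auto intro: finite_lattice_onD[OF assms(1)])

lemma coverD:
  assumes "cover L x y"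
  shows "x \<in> L" "y \<in> L" "x < y" "z \<in> L \<Longrightarrow> x < z \<Longrightarrow> \<not> z < y"
  using assms by (auto simp: cover_def)

lemma cover_atMost: "cover (L \<inter> {..m}) x y \<longleftrightarrow> cover L x y \<and> y \<le> m"
  by (auto simp: cover_def)

lemma cover_atLeast: "cover (L \<inter> {j..}) x y \<longleftrightarrow> cover L x y \<and> j \<le> x"
  by (auto simp: cover_def)

lemma ex_lower_cover_above:
  assumes "finite L" "z \<in> L" "x \<in> L" "z < x"
  obtains y where "cover L y x" "z \<le> y"
proof -
  have "finite {y \<in> L. y < x}" "z \<in> {y \<in> L. y < x}" using assms by auto
  from finite_has_maximal2[OF this] obtain y where
    "y \<in> L" "y < x" "z \<le> y" "\<forall>b\<in>{y \<in> L. y < x}. y \<le> b \<longrightarrow> y = b" by auto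
  then show thesis by (intro that[of y]) (use assms in \<open>auto simp: cover_def\<close>)
qed

lemma ex_upper_cover_below:
  assumes "finite L" "x \<in> L" "z \<in> L" "x < z"
  obtains y where "cover L x y" "y \<le> z"
proof -
  have "finite {y \<in> L. x < y}" "z \<in> {y \<in> L. x < y}" using assms by auto
  from finite_has_minimal2[OF this] obtain y where
    "y \<in> L" "x < y" "y \<le> z" "\<forall>b\<in>{y \<in> L. x < y}. b \<le> y \<longrightarrow> y = b" by auto
  then show thesis by (intro that[of y]) (use assms in \<open>auto simp: cover_def\<close>)
qed

lemma cover_lower_cover:
  assumes "j \<in> join_irreducibles L"
  shows "cover L (lower_cover L j) j"
  using assms unfolding join_irreducibles_def lower_cover_def by (auto intro: theI')

lemma le_lower_cover:
  assumes "finite L" "j \<in> join_irreducibles L" "z \<in> L" "z < j"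
  shows "z \<le> lower_cover L j"
proof -
  have "j \<in> L" and uniq: "\<exists>!x. cover L x j" using assms(2) by (auto simp: join_irreducibles_def)
  from ex_lower_cover_above[OF assms(1,3) this(1) assms(4)]
  obtain y where y: "cover L y j" "z \<le> y" .
  with uniq cover_lower_cover[OF assms(2)] have "y = lower_cover L j" by blast
  with y show ?thesis by simp
qed

text \<open>A down-interval keeps all lower covers of its elements. An up-interval may lose some, so
  its join-irreducibles are reached through the map \<open>sup j0\<close> instead.\<close>

lemma join_irreducibles_atMost:
  "join_irreducibles (L \<inter> {..m}) = {j \<in> join_irreducibles L. j \<le> m}"
  by (auto simp: join_irreducibles_def cover_atMost)

lemma pairing_kappa: "uniquely_paired L \<Longrightarrow> pairing L (kappa L)"
  by (simp add: uniquely_paired_def kappa_def theI')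

lemma bij_betw_kappa:
  "uniquely_paired L \<Longrightarrow> bij_betw (kappa L) (join_irreducibles L) (meet_irreducibles L)"
  using pairing_kappa by (auto simp: pairing_def)

lemma kappa_meet_candidate:
  "uniquely_paired L \<Longrightarrow> j \<in> join_irreducibles L \<Longrightarrow> kappa L j \<in> meet_candidates L j"
  using pairing_kappa by (auto simp: pairing_def)

lemma
  assumes "uniquely_paired L" "j \<in> join_irreducibles L"
  shows kappa_in: "kappa L j \<in> L"
    and lower_cover_eq_inf_kappa: "lower_cover L j = inf j (kappa L j)"
  using kappa_meet_candidate[OF assms] by (auto simp: meet_candidates_def maximal_elements_def)

lemma not_le_kappa:
  assumes "uniquely_paired L" "j \<in> join_irreducibles L"
  shows "\<not> j \<le> kappa L j"
proof
  assume "j \<le> kappa L j"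
  then have "lower_cover L j = j" using lower_cover_eq_inf_kappa[OF assms] by (simp add: inf_absorb1)
  with coverD(3)[OF cover_lower_cover[OF assms(2)]] show False by simp
qed

text \<open>Compatibility below is phrased through \<open>kappa_inv\<close> and meet-irreducibles;
  inverting it gives the form that labels and independent sets use.\<close>

lemma kappa_atMost:
  assumes "uniquely_paired L" "uniquely_paired (L \<inter> {..m0})" "compatible_below L m0"
    and j: "j \<in> join_irreducibles L" "j \<le> m0"
  shows "kappa (L \<inter> {..m0}) j = inf m0 (kappa L j)"
proof -
  let ?L = "L \<inter> {..m0}" and ?m = "kappa L j"
  have m: "?m \<in> meet_irreducibles L" using bij_betwE[OF bij_betw_kappa[OF assms(1)]] j by auto
  have inv: "kappa_inv L ?m = j"
    unfolding kappa_inv_def using bij_betw_kappa[OF assms(1)] j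
    by (auto simp: bij_betw_def intro: inv_into_f_f)
  have "inf m0 ?m \<in> meet_irreducibles ?L"
    using assms(3) m inv j(2) by (auto simp: compatible_below_def dest!: bij_betwE)
  moreover have "kappa_inv ?L (inf m0 ?m) = j"
    using assms(3) m inv j(2) by (auto simp: compatible_below_def)
  ultimately show ?thesis
    using bij_betw_kappa[OF assms(2)] f_inv_into_f
    unfolding kappa_inv_def bij_betw_def by metis
qed

lemma compatibly_dismantlable_uniquely_paired:
  "compatibly_dismantlable L \<Longrightarrow> uniquely_paired L"
  by (auto elim: compatibly_dismantlable.cases)

section \<open>Splitting along a prime pair\<close>

lemma independent_set_iff:
  "independent_set L I \<longleftrightarrow>
     I \<subseteq> join_irreducibles L \<and> (\<forall>i\<in>I. \<forall>j\<in>I. i \<noteq> j \<longrightarrow> i \<le> kappa L j)"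
  by (auto simp: independent_set_def galois_graph_def)

lemma finite_independent_sets: "finite L \<Longrightarrow> finite {I. independent_set L I}"
  by (rule finite_subset[of _ "Pow L"]) (auto simp: independent_set_iff join_irreducibles_def)

text \<open>One step of the dismantling; both inductions on \<open>compatibly_dismantlable\<close>
  interpret it in their \<open>dismantle\<close> case.\<close>

locale prime_paired =
  fixes L :: "'a::lattice set" and j0 m0
  assumes fin_lattice: "finite_lattice_on L"
    and paired: "uniquely_paired L"
    and prime: "prime_pair L j0 m0"
begin

lemma j0_in: "j0 \<in> L" and m0_in: "m0 \<in> L"
  using prime by (auto simp: prime_pair_def)

lemma not_j0_le_m0: "\<not> j0 \<le> m0"
  using prime by (auto simp: prime_pair_def)

lemma below_or_above: "z \<in> L \<Longrightarrow> z \<le> m0 \<or> j0 \<le> z"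
  using prime by (auto simp: prime_pair_def)

lemma not_below_and_above: "z \<le> m0 \<Longrightarrow> \<not> j0 \<le> z"
  using not_j0_le_m0 order_trans by blast

text \<open>An element strictly below \<open>j0\<close> is not above \<open>j0\<close>, hence lies
  below \<open>m0\<close>; so \<open>inf j0 m0\<close> is the greatest element strictly below
  \<open>j0\<close>.\<close>

lemma cover_j0_iff: "cover L x j0 \<longleftrightarrow> x = inf j0 m0"
proof -
  have inL: "inf j0 m0 \<in> L" by (intro finite_lattice_onD[OF fin_lattice] j0_in m0_in)
  have lt: "inf j0 m0 < j0" using not_j0_le_m0 by (simp add: less_le_not_le)
  have le: "z \<le> inf j0 m0" if "z \<in> L" "z < j0" for z
    using below_or_above[OF that(1)] that(2) by (auto simp: less_imp_le)
  show ?thesis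
  proof
    assume "cover L x j0"
    with inL lt le[of x] show "x = inf j0 m0" by (auto simp: cover_def order.order_iff_strict)
  next
    assume "x = inf j0 m0"
    moreover have "\<not> z < j0" if "z \<in> L" "inf j0 m0 < z" for z using le that by (meson leD)
    ultimately show "cover L x j0" using inL lt j0_in by (auto simp: cover_def)
  qed
qed

lemma j0_join_irreducible: "j0 \<in> join_irreducibles L"
  using j0_in by (auto simp: join_irreducibles_def cover_j0_iff)

text \<open>As \<open>kappa L j0\<close> is not above \<open>j0\<close>, it is below
  \<open>m0\<close>. Since \<open>m0\<close> satisfies the same equation
  \<open>lower_cover L j0 = inf j0 m0\<close>, maximality excludes a strict inequality.\<close>

lemma kappa_j0: "kappa L j0 = m0"
proof -
  have lc: "lower_cover L j0 = inf j0 m0"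
    unfolding lower_cover_def by (simp add: cover_j0_iff)
  have "kappa L j0 \<in> L" "\<not> j0 \<le> kappa L j0"
    using kappa_in not_le_kappa paired j0_join_irreducible by auto
  then have "kappa L j0 \<le> m0" using below_or_above by blast
  moreover have "\<not> kappa L j0 < m0"
    using kappa_meet_candidate[OF paired j0_join_irreducible] lc m0_in
    by (auto simp: meet_candidates_def maximal_elements_def)
  ultimately show ?thesis by simp
qed

text \<open>Otherwise \<open>kappa L j \<le> m0\<close>, and
  \<open>j0 \<le> lower_cover L j = inf j (kappa L j)\<close> would put \<open>j0\<close> below
  \<open>m0\<close>.\<close>

lemma j0_le_kappa:
  assumes "j \<in> join_irreducibles L" "j0 \<le> j" "j \<noteq> j0"
  shows "j0 \<le> kappa L j"
proof (rule ccontr)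
  assume "\<not> ?thesis"
  then have "kappa L j \<le> m0" using below_or_above kappa_in[OF paired assms(1)] by blast
  moreover have "j0 \<le> lower_cover L j"
    using assms j0_in fin_lattice by (intro le_lower_cover) (auto simp: finite_lattice_on_def)
  ultimately show False
    using not_j0_le_m0 lower_cover_eq_inf_kappa[OF paired assms(1)] by (auto dest: order_trans)
qed

section \<open>Independent sets of the two intervals\<close>

text \<open>For \<open>i \<le> m0\<close>, lying below \<open>inf m0 (kappa L j)\<close> and below
  \<open>kappa L j\<close> are the same, so the Galois graph of the lower interval is an induced
  subgraph.\<close>

lemma independent_set_atMost:
  assumes "uniquely_paired (L \<inter> {..m0})" "compatible_below L m0"
  shows "independent_set (L \<inter> {..m0}) I \<longleftrightarrow> independent_set L I \<and> I \<subseteq> {..m0}"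
  using kappa_atMost[OF paired assms]
  by (fastforce simp: independent_set_iff join_irreducibles_atMost)

text \<open>If \<open>j0 \<le> kappa L j\<close>, then \<open>sup j0 i \<le> kappa L j\<close>
  amounts to \<open>i \<le> kappa L j\<close>. Hence \<open>sup j0\<close> is an isomorphism from an
  induced subgraph of the Galois graph onto that of the upper interval.\<close>

lemma card_independent_sets_atLeast:
  assumes "compatible_above L j0"
  shows "card {I. independent_set (L \<inter> {j0..}) I} =
         card {I. independent_set L I \<and> (\<forall>i\<in>I. j0 \<le> kappa L i)}"
proof -
  let ?U = "L \<inter> {j0..}" and ?A = "{j \<in> join_irreducibles L. j0 \<le> kappa L j}"
  let ?I = "{I. independent_set L I \<and> (\<forall>i\<in>I. j0 \<le> kappa L i)}"
  have inj: "inj_on (sup j0) ?A" and img: "sup j0 ` ?A = join_irreducibles ?U"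
    and kap: "\<And>j. j \<in> ?A \<Longrightarrow> kappa ?U (sup j0 j) = kappa L j"
    using assms by (auto simp: compatible_above_def bij_betw_def)
  have iff: "independent_set ?U (sup j0 ` I) \<longleftrightarrow> independent_set L I" if "I \<subseteq> ?A" for I
  proof -
    have "sup j0 i = sup j0 j \<longleftrightarrow> i = j" if "i \<in> I" "j \<in> I" for i j
      using inj_on_eq_iff[OF inj] that \<open>I \<subseteq> ?A\<close> by blast
    moreover have "sup j0 ` I \<subseteq> join_irreducibles ?U" using that img by blast
    ultimately show ?thesis
      unfolding independent_set_iff using kap that by (auto simp: subset_iff)
  qed
  have image_eq: "image (sup j0) ` ?I = {I. independent_set ?U I}"
  proof (intro equalityI subsetI)
    fix K assume "K \<in> image (sup j0) ` ?I"
    then obtain I where "I \<in> ?I" "K = sup j0 ` I" by blast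
    moreover from this have "I \<subseteq> ?A" by (auto simp: independent_set_iff)
    ultimately show "K \<in> {I. independent_set ?U I}" using iff by simp
  next
    fix K assume K: "K \<in> {I. independent_set ?U I}"
    then have "K \<subseteq> sup j0 ` ?A" using img by (auto simp: independent_set_iff)
    then obtain I where "I \<subseteq> ?A" "K = sup j0 ` I" by (auto simp: subset_image_iff)
    with K iff show "K \<in> image (sup j0) ` ?I" by blast
  qed
  have "inj_on (image (sup j0)) ?I"
    by (rule inj_on_subset[OF inj_on_image_Pow[OF inj]]) (auto simp: independent_set_iff)
  then show ?thesis using card_image unfolding image_eq[symmetric] by blast
qed

text \<open>
  Deleting \<open>j0\<close> maps the independent sets not contained in the lower interval bijectively onto
  those of the upper interval: an element \<open>i\<close> with \<open>j0 \<le> i\<close> of such a set forces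
  $j_0 \le i \le \kappa(j)$ for all its other elements \<open>j\<close>.
\<close>

lemma card_independent_sets_not_below:
  "card {I. independent_set L I \<and> \<not> I \<subseteq> {..m0}} =
   card {I. independent_set L I \<and> (\<forall>i\<in>I. j0 \<le> kappa L i)}" (is "card ?B = card ?C")
proof -
  \<comment> \<open>The inverse of the deletion. What remains of an independent set after
    \<open>j0\<close> is deleted lies below \<open>kappa L j0 = m0\<close>, so
    \<open>K \<subseteq> {..m0}\<close> detects that \<open>j0\<close> has to be put back.\<close>
  let ?g = "\<lambda>K. if K \<subseteq> {..m0} then insert j0 K else K"
  have j0K: "j0 \<notin> K" if "K \<in> ?C" for K
    using that not_j0_le_m0 kappa_j0 by auto
  have "\<forall>I\<in>?B. ?g (I - {j0}) = I"
  proof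
    fix I assume I: "I \<in> ?B"
    show "?g (I - {j0}) = I"
    proof (cases "j0 \<in> I")
      case True
      then have "\<forall>j\<in>I - {j0}. j \<le> m0" using I kappa_j0 by (fastforce simp: independent_set_iff)
      with True show ?thesis by auto
    qed (use I in auto)
  qed
  moreover have "\<forall>K\<in>?C. ?g K - {j0} = K" using j0K by auto
  moreover have "(\<lambda>I. I - {j0}) ` ?B \<subseteq> ?C"
  proof
    fix K assume "K \<in> (\<lambda>I. I - {j0}) ` ?B"
    then obtain I where I: "independent_set L I" "\<not> I \<subseteq> {..m0}" "K = I - {j0}" by blast
    then obtain i where i: "i \<in> I" "\<not> i \<le> m0" by auto
    with I(1) have "j0 \<le> i"
      using below_or_above by (auto simp: independent_set_iff join_irreducibles_def)
    have "j0 \<le> kappa L j" if "j \<in> I" "j \<noteq> j0" for j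
    proof (cases "j = i")
      case True
      with that I(1) \<open>j0 \<le> i\<close> show ?thesis
        by (intro j0_le_kappa) (auto simp: independent_set_iff)
    next
      case False
      with I(1) i that have "i \<le> kappa L j" by (auto simp: independent_set_iff)
      with \<open>j0 \<le> i\<close> show ?thesis by simp
    qed
    with I show "K \<in> ?C" by (auto simp: independent_set_iff)
  qed
  \<comment> \<open>Adding \<open>j0\<close> creates no edge: \<open>i \<le> m0 = kappa L j0\<close>
    excludes one direction, and \<open>j0 \<le> kappa L i\<close> from \<open>?C\<close> the
    other.\<close>
  moreover have "?g ` ?C \<subseteq> ?B"
    using not_j0_le_m0 kappa_j0 j0_join_irreducible by (auto simp: independent_set_iff)
  ultimately have "bij_betw (\<lambda>I. I - {j0}) ?B ?C" by (rule bij_betw_byWitness)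
  then show ?thesis by (rule bij_betw_same_card)
qed

lemma card_independent_sets_split:
  assumes "uniquely_paired (L \<inter> {..m0})" "compatible_below L m0" "compatible_above L j0"
  shows "card {I. independent_set L I} =
    card {I. independent_set (L \<inter> {..m0}) I} + card {I. independent_set (L \<inter> {j0..}) I}"
proof -
  let ?A = "{I. independent_set L I \<and> I \<subseteq> {..m0}}"
  let ?B = "{I. independent_set L I \<and> \<not> I \<subseteq> {..m0}}"
  have "finite {I. independent_set L I}"
    using finite_lattice_onD(1)[OF fin_lattice] by (rule finite_independent_sets)
  then have "finite ?A" "finite ?B" by simp_all
  then have "card (?A \<union> ?B) = card ?A + card ?B" by (intro card_Un_disjoint) auto
  moreover have "{I. independent_set L I} = ?A \<union> ?B" by auto
  ultimately have "card {I. independent_set L I} = card ?A + card ?B" by (simp only:)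
  then show ?thesis
    unfolding card_independent_sets_not_below card_independent_sets_atLeast[OF assms(3)]
      independent_set_atMost[OF assms(1,2)] .
qed

lemma card_split: "card L = card (L \<inter> {..m0}) + card (L \<inter> {j0..})"
  using prime finite_lattice_onD(1)[OF fin_lattice] unfolding prime_pair_def
  by (metis card_Un_disjoint finite_Int)

section \<open>Labels of covers along a prime pair\<close>

text \<open>For such a cover \<open>inf y m0 = x\<close> and \<open>sup x j0 = y\<close>. A label
  \<open>j \<le> m0\<close> would be below \<open>x\<close>, and one with
  \<open>j0 \<le> kappa L j\<close> would have \<open>y\<close> below \<open>kappa L j\<close>; both
  give \<open>j \<le> kappa L j\<close>. By \<open>j0_le_kappa\<close> only \<open>j0\<close> is
  left.\<close>

lemma label_unique_across:
  assumes "cover L x y" "x \<le> m0" "j0 \<le> y"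
  shows "M_set L x \<inter> J_set L y = {j0}"
proof (intro equalityI subsetI)
  fix j assume "j \<in> {j0}"
  then show "j \<in> M_set L x \<inter> J_set L y"
    using assms j0_join_irreducible kappa_j0 by (auto simp: M_set_def J_set_def)
next
  fix j assume "j \<in> M_set L x \<inter> J_set L y"
  then have j: "j \<in> join_irreducibles L" "x \<le> kappa L j" "j \<le> y"
    by (auto simp: M_set_def J_set_def)
  have xy: "x \<in> L" "y \<in> L" "x < y" "\<And>z. z \<in> L \<Longrightarrow> x < z \<Longrightarrow> \<not> z < y"
    using coverD[OF assms(1)] by auto
  have "\<not> j \<le> m0"
  proof
    assume "j \<le> m0"
    have "inf y m0 \<in> L" using finite_lattice_onD[OF fin_lattice] xy m0_in by blast
    moreover have "x \<le> inf y m0" using xy assms by (simp add: less_imp_le)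
    moreover have "inf y m0 < y"
      using assms(3) not_below_and_above by (auto simp: less_le_not_le)
    ultimately have "inf y m0 = x" using xy(4) by (auto simp: order.order_iff_strict)
    with \<open>j \<le> m0\<close> j have "j \<le> kappa L j" by (metis inf.boundedI order_trans)
    with not_le_kappa[OF paired j(1)] show False ..
  qed
  then have "j0 \<le> j" using below_or_above j(1) by (auto simp: join_irreducibles_def)
  have "\<not> j0 \<le> kappa L j"
  proof
    assume "j0 \<le> kappa L j"
    have "sup x j0 \<in> L" using finite_lattice_onD[OF fin_lattice] xy j0_in by blast
    moreover have "sup x j0 \<le> y" using xy assms by (simp add: less_imp_le)
    moreover have "x < sup x j0"
      using assms(2) not_below_and_above by (auto simp: less_le_not_le)
    ultimately have "sup x j0 = y" using xy(4) by (auto simp: order.order_iff_strict)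
    with \<open>j0 \<le> kappa L j\<close> j have "j \<le> kappa L j" by (metis sup.boundedI order_trans)
    with not_le_kappa[OF paired j(1)] show False ..
  qed
  with j0_le_kappa[OF j(1) \<open>j0 \<le> j\<close>] show "j \<in> {j0}" by blast
qed

lemma labels_atMost:
  assumes "uniquely_paired (L \<inter> {..m0})" "compatible_below L m0" "x \<le> m0" "y \<le> m0"
  shows "M_set (L \<inter> {..m0}) x \<inter> J_set (L \<inter> {..m0}) y = M_set L x \<inter> J_set L y"
  using kappa_atMost[OF paired assms(1,2)] assms(3,4)
  by (auto simp: M_set_def J_set_def join_irreducibles_atMost dest: order_trans)

text \<open>Every \<open>j\<close> in \<open>M_set L x\<close> has
  \<open>j0 \<le> x \<le> kappa L j\<close>, so \<open>sup j0\<close> is injective there and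
  preserves \<open>kappa\<close>; because \<open>j0 \<le> y\<close>, it also preserves being below
  \<open>y\<close>.\<close>

lemma labels_atLeast:
  assumes "compatible_above L j0" "j0 \<le> x" "j0 \<le> y"
  shows "bij_betw (sup j0) (M_set L x \<inter> J_set L y)
    (M_set (L \<inter> {j0..}) x \<inter> J_set (L \<inter> {j0..}) y)"
proof -
  let ?U = "L \<inter> {j0..}" and ?A = "{j \<in> join_irreducibles L. j0 \<le> kappa L j}"
  have inj: "inj_on (sup j0) ?A" and img: "sup j0 ` ?A = join_irreducibles ?U"
    and kap: "\<And>j. j \<in> ?A \<Longrightarrow> kappa ?U (sup j0 j) = kappa L j"
    using assms by (auto simp: compatible_above_def bij_betw_def)
  have sub: "M_set L x \<inter> J_set L y \<subseteq> ?A"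
    using assms(2) by (auto simp: M_set_def)
  have "sup j0 ` (M_set L x \<inter> J_set L y) = M_set ?U x \<inter> J_set ?U y"
  proof (intro equalityI subsetI)
    fix i assume "i \<in> sup j0 ` (M_set L x \<inter> J_set L y)"
    then obtain j where j: "j \<in> M_set L x \<inter> J_set L y" "i = sup j0 j" by blast
    with sub have "j \<in> ?A" by blast
    with j assms(3) img kap show "i \<in> M_set ?U x \<inter> J_set ?U y"
      by (auto simp: M_set_def J_set_def)
  next
    fix i assume i: "i \<in> M_set ?U x \<inter> J_set ?U y"
    then obtain j where "j \<in> ?A" "i = sup j0 j" using img by (auto simp: M_set_def)
    with i kap show "i \<in> sup j0 ` (M_set L x \<inter> J_set L y)"
      by (auto simp: M_set_def J_set_def)
  qed
  with inj_on_subset[OF inj sub] show ?thesis by (simp add: bij_betw_def)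
qed

end

section \<open>Labels of covers in compatibly dismantlable lattices\<close>

text \<open>Both sides are additive along a prime pair, and both are 1 for a one-element lattice,
  where only the empty set is independent.\<close>

lemma card_independent_sets:
  assumes "compatibly_dismantlable L" "finite_lattice_on L"
  shows "card {I. independent_set L I} = card L"
  using assms
proof (induction rule: compatibly_dismantlable.induct)
  case (singleton L)
  then obtain a where "L = {a}" by (auto simp: card_1_singleton_iff)
  then have "join_irreducibles L = {}" by (auto simp: join_irreducibles_def cover_def)
  then have "{I. independent_set L I} = {{}}" by (auto simp: independent_set_iff)
  with singleton show ?case by simp
next
  case (dismantle L j0 m0)
  interpret prime_paired L j0 m0 using dismantle by unfold_locales auto
  show ?case
    using card_independent_sets_split card_split dismantle
      compatibly_dismantlable_uniquely_paired
      finite_lattice_on_atMost[OF fin_lattice m0_in]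
      finite_lattice_on_atLeast[OF fin_lattice j0_in] by metis
qed

text \<open>A cover stays inside one interval, where induction applies, or crosses from the lower to
  the upper one, where the label is \<open>j0\<close>. This gives \<open>the_elem\<close> in
  \<open>cover_label\<close> its meaning.\<close>

lemma card_labels:
  assumes "compatibly_dismantlable L" "finite_lattice_on L" "cover L x y"
  shows "card (M_set L x \<inter> J_set L y) = 1"
  using assms
proof (induction rule: compatibly_dismantlable.induct)
  case (singleton L)
  then show ?case by (auto simp: card_1_singleton_iff cover_def)
next
  case (dismantle L j0 m0)
  interpret prime_paired L j0 m0 using dismantle by unfold_locales auto
  have xy: "x \<in> L" "y \<in> L" "x \<le> y" using coverD(1-3)[OF dismantle.prems(2)] by auto
  consider "y \<le> m0" | "j0 \<le> x" | "x \<le> m0" "j0 \<le> y"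
    using below_or_above xy by blast
  then show ?case
  proof cases
    case 1
    have "card (M_set (L \<inter> {..m0}) x \<inter> J_set (L \<inter> {..m0}) y) = 1"
      using dismantle 1 by (intro dismantle.IH finite_lattice_on_atMost m0_in) (auto simp: cover_atMost)
    moreover have "uniquely_paired (L \<inter> {..m0})"
      using dismantle compatibly_dismantlable_uniquely_paired by blast
    ultimately show ?thesis using labels_atMost dismantle 1 xy by auto
  next
    case 2
    have "card (M_set (L \<inter> {j0..}) x \<inter> J_set (L \<inter> {j0..}) y) = 1"
      using dismantle 2 by (intro dismantle.IH finite_lattice_on_atLeast j0_in) (auto simp: cover_atLeast)
    moreover have "j0 \<le> y" using 2 xy by simp
    ultimately show ?thesis
      using bij_betw_same_card[OF labels_atLeast[OF \<open>compatible_above L j0\<close> 2]] by simp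
  next
    case 3
    then show ?thesis using label_unique_across dismantle by simp
  qed
qed

locale compatibly_dismantlable_lattice =
  fixes L :: "'a::lattice set"
  assumes fin_lattice: "finite_lattice_on L"
    and dismantlable: "compatibly_dismantlable L"
begin

lemma finite_L: "finite L"
  using finite_lattice_onD(1)[OF fin_lattice] .

lemma cover_label:
  assumes "cover L x y"
  shows "cover_label L x y \<in> join_irreducibles L" "x \<le> kappa L (cover_label L x y)"
    "cover_label L x y \<le> y" "\<not> cover_label L x y \<le> kappa L (cover_label L x y)"
proof -
  obtain j where j: "M_set L x \<inter> J_set L y = {j}"
    using card_labels[OF dismantlable fin_lattice assms] by (auto simp: card_1_singleton_iff)
  then have "cover_label L x y \<in> M_set L x \<inter> J_set L y" by (simp add: cover_label_def)
  then show "cover_label L x y \<in> join_irreducibles L" "x \<le> kappa L (cover_label L x y)"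
    "cover_label L x y \<le> y" by (auto simp: M_set_def J_set_def)
  then show "\<not> cover_label L x y \<le> kappa L (cover_label L x y)"
    using not_le_kappa compatibly_dismantlable_uniquely_paired[OF dismantlable] by blast
qed

section \<open>Elements determined by their labels\<close>

lemma downward_labelE:
  assumes "j \<in> downward_labels L x"
  obtains y where "cover L y x" "j \<in> join_irreducibles L" "y \<le> kappa L j" "j \<le> x"
  using assms cover_label by (auto simp: downward_labels_def)

lemma upward_labelE:
  assumes "j \<in> upward_labels L x"
  obtains y where "cover L x y" "j \<in> join_irreducibles L" "x \<le> kappa L j" "j \<le> y"
  using assms cover_label by (auto simp: upward_labels_def)

text \<open>The label of a lower cover \<open>y\<close> of \<open>x\<close> above \<open>z\<close>
  works, because \<open>z \<le> y \<le> kappa L j\<close>. So \<open>j\<close> and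
  \<open>kappa L j\<close> separate \<open>x\<close> from \<open>z\<close>.\<close>

lemma downward_label_between:
  assumes "z \<in> L" "x \<in> L" "z < x"
  obtains j where "j \<in> downward_labels L x" "j \<le> x" "z \<le> kappa L j" "\<not> j \<le> kappa L j"
proof -
  obtain y where "cover L y x" "z \<le> y" using ex_lower_cover_above[OF finite_L assms] .
  then show thesis using cover_label[of y x]
    by (intro that[of "cover_label L y x"]) (auto simp: downward_labels_def)
qed

lemma upward_label_between:
  assumes "x \<in> L" "z \<in> L" "x < z"
  obtains j where "j \<in> upward_labels L x" "j \<le> z" "x \<le> kappa L j" "\<not> j \<le> kappa L j"
proof -
  obtain y where "cover L x y" "y \<le> z" using ex_upper_cover_below[OF finite_L assms] .
  then show thesis using cover_label[of x y]
    by (intro that[of "cover_label L x y"]) (auto simp: upward_labels_def)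
qed

text \<open>If \<open>x\<close> is not below \<open>z\<close>, the label separating \<open>x\<close>
  from \<open>inf x z\<close> would be below both \<open>x\<close> and \<open>z\<close>, hence below
  its own \<open>kappa\<close>.\<close>

lemma le_iff_downward_labels:
  assumes "x \<in> L" "z \<in> L"
  shows "x \<le> z \<longleftrightarrow> (\<forall>j\<in>downward_labels L x. j \<le> z)"
proof
  assume "x \<le> z"
  then show "\<forall>j\<in>downward_labels L x. j \<le> z" by (auto elim!: downward_labelE)
next
  assume *: "\<forall>j\<in>downward_labels L x. j \<le> z"
  show "x \<le> z"
  proof (rule ccontr)
    assume "\<not> x \<le> z"
    then have "inf x z < x" by (auto simp: less_le_not_le)
    then obtain j where "j \<in> downward_labels L x" "j \<le> x" "inf x z \<le> kappa L j" "\<not> j \<le> kappa L j"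
      using downward_label_between finite_lattice_onD[OF fin_lattice] assms by metis
    with * show False by (meson inf.boundedI order_trans)
  qed
qed

lemma le_iff_upward_labels:
  assumes "x \<in> L" "z \<in> L"
  shows "z \<le> x \<longleftrightarrow> (\<forall>j\<in>upward_labels L x. z \<le> kappa L j)"
proof
  assume "z \<le> x"
  then show "\<forall>j\<in>upward_labels L x. z \<le> kappa L j" by (auto elim!: upward_labelE)
next
  assume *: "\<forall>j\<in>upward_labels L x. z \<le> kappa L j"
  show "z \<le> x"
  proof (rule ccontr)
    assume "\<not> z \<le> x"
    then have "x < sup x z" by (auto simp: less_le_not_le)
    then obtain j where "j \<in> upward_labels L x" "j \<le> sup x z" "x \<le> kappa L j" "\<not> j \<le> kappa L j"
      using upward_label_between finite_lattice_onD[OF fin_lattice] assms by metis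
    with * show False by (meson sup.boundedI order_trans)
  qed
qed

lemma inj_on_downward_labels: "inj_on (downward_labels L) L"
proof (rule inj_onI)
  fix x y assume "x \<in> L" "y \<in> L" "downward_labels L x = downward_labels L y"
  then have "x \<le> y" "y \<le> x"
    using le_iff_downward_labels[of x x] le_iff_downward_labels[of y y]
      le_iff_downward_labels[of x y] le_iff_downward_labels[of y x] by simp_all
  then show "x = y" by simp
qed

lemma inj_on_upward_labels: "inj_on (upward_labels L) L"
proof (rule inj_onI)
  fix x y assume "x \<in> L" "y \<in> L" "upward_labels L x = upward_labels L y"
  then have "x \<le> y" "y \<le> x"
    using le_iff_upward_labels[of x x] le_iff_upward_labels[of y y]
      le_iff_upward_labels[of x y] le_iff_upward_labels[of y x] by simp_all
  then show "x = y" by simp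
qed

section \<open>Pop operators expressed through labels\<close>

lemma finite_lower_covers: "finite {y. cover L y x}"
  by (rule finite_subset[OF _ finite_L]) (auto dest: coverD(1))

lemma finite_upper_covers: "finite {y. cover L x y}"
  by (rule finite_subset[OF _ finite_L]) (auto dest: coverD(2))

lemma pop_down_in: "x \<in> L \<Longrightarrow> pop_down L x \<in> L"
  unfolding pop_down_def using finite_lower_covers
  by (intro Inf_fin_in_finite_lattice[OF fin_lattice]) (auto dest: coverD(1))

lemma pop_up_in: "x \<in> L \<Longrightarrow> pop_up L x \<in> L"
  unfolding pop_up_def using finite_upper_covers
  by (intro Sup_fin_in_finite_lattice[OF fin_lattice]) (auto dest: coverD(2))

lemma le_pop_down_iff: "z \<le> pop_down L x \<longleftrightarrow> z \<le> x \<and> (\<forall>y. cover L y x \<longrightarrow> z \<le> y)"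
  unfolding pop_down_def using finite_lower_covers by (subst Inf_fin.bounded_iff) auto

lemma pop_up_le_iff: "pop_up L x \<le> z \<longleftrightarrow> x \<le> z \<and> (\<forall>y. cover L x y \<longrightarrow> y \<le> z)"
  unfolding pop_up_def using finite_upper_covers by (subst Sup_fin.bounded_iff) auto

text \<open>Here \<open>r\<close> anticipates the rowmotion of \<open>x\<close>; its existence comes
  later, from the count of independent sets.\<close>

lemma pop_down_eq_inf:
  assumes "x \<in> L" "r \<in> L" "upward_labels L r = downward_labels L x"
  shows "pop_down L x = inf x r"
proof (rule order.antisym)
  have "pop_down L x \<le> kappa L j" if "j \<in> downward_labels L x" for j
    using that le_pop_down_iff[of "pop_down L x" x] by (auto elim!: downward_labelE)
  then have "pop_down L x \<le> r" using assms le_iff_upward_labels pop_down_in by simp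
  then show "pop_down L x \<le> inf x r" using le_pop_down_iff[of "pop_down L x" x] by simp
  have "inf x r \<le> y" if y: "cover L y x" for y
  proof -
    let ?j = "cover_label L y x"
    have j: "y \<le> kappa L ?j" "?j \<le> x" "\<not> ?j \<le> kappa L ?j" using cover_label[OF y] by auto
    have kL: "kappa L ?j \<in> L"
      using cover_label(1)[OF y] kappa_in compatibly_dismantlable_uniquely_paired dismantlable by blast
    have "?j \<in> upward_labels L r" using assms(3) y by (auto simp: downward_labels_def)
    then have "r \<le> kappa L ?j" by (auto elim!: upward_labelE)
    \<comment> \<open>The meet is at least \<open>y\<close>, and strictly below \<open>x\<close>
      because \<open>?j\<close> is below \<open>x\<close> but not below \<open>kappa L ?j\<close>;
      the cover leaves only \<open>y\<close>.\<close>
    moreover have "inf x (kappa L ?j) = y"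
    proof -
      have "inf x (kappa L ?j) \<in> L" using finite_lattice_onD[OF fin_lattice] assms(1) kL by blast
      moreover have "inf x (kappa L ?j) < x"
        using j by (auto simp: less_le_not_le dest: order_trans)
      moreover have "y \<le> inf x (kappa L ?j)" using j coverD(3)[OF y] by (simp add: less_imp_le)
      ultimately show ?thesis using coverD(4)[OF y] by (auto simp: order.order_iff_strict)
    qed
    ultimately show ?thesis by (metis inf_mono order_refl)
  qed
  then show "inf x r \<le> pop_down L x" by (simp add: le_pop_down_iff)
qed

text \<open>The dual, with \<open>w\<close> anticipating the inverse rowmotion; an upper cover is
  recovered as \<open>sup x j\<close> from its label \<open>j\<close>.\<close>

lemma pop_up_eq_sup:
  assumes "x \<in> L" "w \<in> L" "downward_labels L w = upward_labels L x"
  shows "pop_up L x = sup x w"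
proof (rule order.antisym)
  have "j \<le> pop_up L x" if "j \<in> upward_labels L x" for j
    using that pop_up_le_iff[of x "pop_up L x"] by (auto elim!: upward_labelE)
  then have "w \<le> pop_up L x" using assms le_iff_downward_labels pop_up_in by simp
  then show "sup x w \<le> pop_up L x" using pop_up_le_iff[of x "pop_up L x"] by simp
  have "y \<le> sup x w" if y: "cover L x y" for y
  proof -
    let ?j = "cover_label L x y"
    have j: "?j \<in> join_irreducibles L" "x \<le> kappa L ?j" "?j \<le> y" "\<not> ?j \<le> kappa L ?j"
      using cover_label[OF y] by auto
    have "?j \<in> downward_labels L w" using assms(3) y by (auto simp: upward_labels_def)
    then have "?j \<le> w" by (auto elim!: downward_labelE)
    moreover have "sup x ?j = y"
    proof -
      have "sup x ?j \<in> L"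
        using finite_lattice_onD[OF fin_lattice] assms(1) j(1) by (auto simp: join_irreducibles_def)
      moreover have "x < sup x ?j"
        using j by (auto simp: less_le_not_le dest: order_trans)
      moreover have "sup x ?j \<le> y" using j coverD(3)[OF y] by (simp add: less_imp_le)
      ultimately show ?thesis using coverD(4)[OF y] by (auto simp: order.order_iff_strict)
    qed
    ultimately show ?thesis by (metis sup_mono order_refl)
  qed
  then show "pop_up L x \<le> sup x w" by (simp add: pop_up_le_iff)
qed

lemma maximal_pop_down:
  assumes "x \<in> L" "r \<in> L" "upward_labels L r = downward_labels L x"
  shows "r \<in> maximal_elements {z \<in> L. pop_down L x = inf x z}"
proof -
  have False if z: "z \<in> L" "pop_down L x = inf x z" "r < z" for z
  proof -
    obtain j where j: "j \<in> upward_labels L r" "j \<le> z" "r \<le> kappa L j" "\<not> j \<le> kappa L j"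
      using upward_label_between[OF assms(2) z(1,3)] .
    have "j \<le> x" using j(1) assms(3) by (auto elim!: downward_labelE)
    with j(2) have "j \<le> inf x r" using z(2) pop_down_eq_inf[OF assms] by (metis inf.boundedI)
    with j show False by (meson inf.boundedE order_trans)
  qed
  then show ?thesis using assms pop_down_eq_inf by (auto simp: maximal_elements_def)
qed

text \<open>A smaller \<open>z\<close> yields a downward label \<open>j\<close> of \<open>w\<close>
  with \<open>z \<le> kappa L j\<close>. It is also an upward label of \<open>x\<close>, so
  \<open>j \<le> w \<le> sup x w = sup x z \<le> kappa L j\<close>.\<close>

lemma minimal_pop_up:
  assumes "x \<in> L" "w \<in> L" "downward_labels L w = upward_labels L x"
  shows "w \<in> minimal_elements {z \<in> L. pop_up L x = sup x z}"
proof -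
  have False if z: "z \<in> L" "pop_up L x = sup x z" "z < w" for z
  proof -
    obtain j where j: "j \<in> downward_labels L w" "j \<le> w" "z \<le> kappa L j" "\<not> j \<le> kappa L j"
      using downward_label_between[OF z(1) assms(2) z(3)] .
    have "x \<le> kappa L j" using j(1) assms(3) by (auto elim!: upward_labelE)
    with j(3) have "sup x w \<le> kappa L j" using z(2) pop_up_eq_sup[OF assms] by (metis sup.boundedI)
    with j show False by (meson sup.boundedE order_trans)
  qed
  then show ?thesis using assms pop_up_eq_sup by (auto simp: minimal_elements_def)
qed

end

section \<open>Rowmotion\<close>

locale semidistrim_lattice = compatibly_dismantlable_lattice +
  assumes semidistrim: "semidistrim L"
begin

text \<open>In a semidistrim lattice the independence of the label sets supplies the inclusion;
  equal finite cardinalities do the rest.\<close>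

lemma labelling_surj:
  assumes "inj_on f L" "f ` L \<subseteq> {I. independent_set L I}"
  shows "f ` L = {I. independent_set L I}"
proof (rule card_subset_eq)
  show "finite {I. independent_set L I}"
    using finite_L by (rule finite_independent_sets)
  show "card (f ` L) = card {I. independent_set L I}"
    by (simp add: card_image[OF assms(1)] card_independent_sets[OF dismantlable fin_lattice])
qed (fact assms(2))

lemma downward_labels_image: "downward_labels L ` L = {I. independent_set L I}"
  using semidistrim by (intro labelling_surj inj_on_downward_labels) (auto simp: semidistrim_def)

lemma upward_labels_image: "upward_labels L ` L = {I. independent_set L I}"
  using semidistrim by (intro labelling_surj inj_on_upward_labels) (auto simp: semidistrim_def)

lemma rowmotion:
  assumes "x \<in> L"
  shows "rowmotion L x \<in> L" "upward_labels L (rowmotion L x) = downward_labels L x"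
proof -
  have "downward_labels L x \<in> upward_labels L ` L"
    using assms downward_labels_image upward_labels_image by blast
  then have "\<exists>!z. z \<in> L \<and> upward_labels L z = downward_labels L x"
    using inj_on_upward_labels by (auto simp: inj_on_def)
  from theI'[OF this]
  show "rowmotion L x \<in> L" "upward_labels L (rowmotion L x) = downward_labels L x"
    by (simp_all add: rowmotion_def)
qed

lemma rowmotion_inv:
  assumes "x \<in> L"
  shows "rowmotion_inv L x \<in> L" "downward_labels L (rowmotion_inv L x) = upward_labels L x"
proof -
  have "upward_labels L x \<in> downward_labels L ` L"
    using assms downward_labels_image upward_labels_image by blast
  then obtain w where w: "w \<in> L" "upward_labels L x = downward_labels L w" by blast
  \<comment> \<open>The upward labels of \<open>rowmotion L w\<close> are the downward labels of
    \<open>w\<close>, that is, the upward labels of \<open>x\<close>.\<close>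
  with assms rowmotion inj_on_upward_labels have "rowmotion L w = x"
    by (metis inj_onD)
  with w have "x \<in> rowmotion L ` L" by blast
  \<comment> \<open>\<open>inv_into\<close> returns a genuine preimage only on the image of
    \<open>rowmotion L\<close>, which has just been shown to contain \<open>x\<close>.\<close>
  then have "rowmotion_inv L x \<in> L" "rowmotion L (rowmotion_inv L x) = x"
    unfolding rowmotion_inv_def by (auto intro: inv_into_into f_inv_into_f)
  with rowmotion show "rowmotion_inv L x \<in> L"
    "downward_labels L (rowmotion_inv L x) = upward_labels L x" by metis+
qed

end

theorem theorem9p3:
  fixes L :: "'a::lattice set" and x :: 'a
  assumes "finite_lattice_on L"
    and "semidistrim L"
    and "x \<in> L"
  shows "rowmotion L x \<in> maximal_elements {z \<in> L. pop_down L x = inf x z} \<and>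
         rowmotion_inv L x \<in> minimal_elements {z \<in> L. pop_up L x = sup x z}"
proof -
  interpret semidistrim_lattice L
    using assms by unfold_locales (auto simp: semidistrim_def)
  show ?thesis
    by (intro conjI maximal_pop_down minimal_pop_up rowmotion rowmotion_inv assms(3))
qed

end
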